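(* Let $\lambda\in\mathbb C$, let $G$ be an additive subgroup of $\mathbb C$ (free of rank $\nu\ge 1$ if $\lambda=-2$), and let $g(G,\lambda)$ be the deformed generalized Heisenberg–Virasoro algebra. If $(g(G,\lambda),\cdot,[\cdot,\cdot])$ is a nontrivial transposed Poisson algebra (i.e. $\cdot$ is a transposed Poisson structure on the Lie algebra $(g(G,\lambda),[\cdot,\cdot])$ that is not identically zero), then $\lambda=-1$, $(g(G,\lambda),\cdot,[\cdot,\cdot])$ is a nontrivial Poisson algebra, and there is $\beta\in\mathbb C$ such that $I_0\cdot I_0=\beta C_L$, all other products of basis elements being zero.
   Context: All vector spaces are over $\mathbb C$. A transposed Poisson algebra is a vector space with two nonzero bilinear operations $\cdot$, $[\cdot,\cdot]$ such that $\cdot$ is commutative and associative, $[\cdot,\cdot]$ is a Lie bracket, and $2z\cdot[x,y]=[z\cdot x,y]+[x,z\cdot y]$ for all $x,y,z$. A transposed Poisson structure on a Lie algebra is a commutative associative multiplication on it satisfying this identity; it is trivial if it is identically zero. A Poisson algebra is a vector space with a commutative associative product $\cdot$ and a Lie bracket with $[x,y\cdot z]=[x,y]\cdot z+y\cdot[x,z]$. The algebra $g(G,\lambda)$ has basis $\{L_a,I_a,C_L \mid a\in G\}$ if $\lambda\ne 0,1,-2$; $\{L_a,I_a,C_L,C_I,C_{LI}^{(0)}\mid a\in G\}$ if $\lambda=0$; $\{L_a,I_a,C_L,C_{LI}^{(1)}\mid a\in G\}$ if $\lambda=1$; $\{L_a,I_a,C_L,C_{LI}^{(i)}\mid a\in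 G,\ 2\le i\le \nu\}$ if $\lambda=-2$. The bracket is antisymmetric and determined by $$[L_a,L_b]=(b-a)L_{a+b}+\tfrac1{12}(a^3-a)\delta_{a,-b}C_L,$$ $$[L_a,I_b]=(b-\lambda a)I_{a+b}+\delta_{a,-b}\Big((a^2+a)\delta_{\lambda,0}C_{LI}^{(0)}+\tfrac1{12}(a^3-a)\delta_{\lambda,1}C_{LI}^{(1)}+\delta_{\lambda,-2}\sum_{i=2}^{\nu}a_{(i)}C_{LI}^{(i)}\Big),$$ $$[I_a,I_b]=\delta_{a,-b}\,\delta_{\lambda,0}\,a\,C_I,$$ with all $C$'s central, where for $\lambda=-2$ a $\mathbb Z$-basis $\epsilon_1,\dots,\epsilon_\nu$ of $G$ is fixed and $a=\sum_{i=1}^\nu a_{(i)}\epsilon_i$ with $a_{(i)}\in\mathbb Z$. No further restriction on $G$ or $\lambda$ is imposed. *)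

theory Defs
  imports Complex_Main "HOL-Library.Poly_Mapping" "HOL-Library.FuncSet"
begin

text \<open>
  Algebras are given by an ambient complex vector space with scalar multiplication
  \<open>scale\<close>, a subspace \<open>V\<close> as carrier, and operations whose values outside \<open>V\<close> are irrelevant.
\<close>

locale complex_space_on = vector_space scale
  for scale :: "complex \<Rightarrow> 'v::ab_group_add \<Rightarrow> 'v" +
  fixes V :: "'v set"
  assumes subspace_carrier: "subspace V"
begin

definition bilinear_op :: "('v \<Rightarrow> 'v \<Rightarrow> 'v) \<Rightarrow> bool" where
  "bilinear_op f \<longleftrightarrow>
     (\<forall>x\<in>V. \<forall>y\<in>V. f x y \<in> V) \<and>
     (\<forall>x\<in>V. \<forall>y\<in>V. \<forall>z\<in>V. f (x + y) z = f x z + f y z) \<and>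
     (\<forall>x\<in>V. \<forall>y\<in>V. \<forall>z\<in>V. f x (y + z) = f x y + f x z) \<and>
     (\<forall>c. \<forall>x\<in>V. \<forall>y\<in>V. f (scale c x) y = scale c (f x y)) \<and>
     (\<forall>c. \<forall>x\<in>V. \<forall>y\<in>V. f x (scale c y) = scale c (f x y))"

end

definition nonzero_op :: "'v set \<Rightarrow> ('v \<Rightarrow> 'v \<Rightarrow> 'v::zero) \<Rightarrow> bool" where
  "nonzero_op V f \<longleftrightarrow> (\<exists>x\<in>V. \<exists>y\<in>V. f x y \<noteq> 0)"

locale comm_assoc_algebra_on = complex_space_on scale V
  for scale :: "complex \<Rightarrow> 'v::ab_group_add \<Rightarrow> 'v" and V :: "'v set" +
  fixes mult :: "'v \<Rightarrow> 'v \<Rightarrow> 'v"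
  assumes mult_bilinear: "bilinear_op mult"
    and mult_commute: "\<lbrakk>x \<in> V; y \<in> V\<rbrakk> \<Longrightarrow> mult x y = mult y x"
    and mult_assoc: "\<lbrakk>x \<in> V; y \<in> V; z \<in> V\<rbrakk> \<Longrightarrow> mult (mult x y) z = mult x (mult y z)"

locale lie_algebra_on = complex_space_on scale V
  for scale :: "complex \<Rightarrow> 'v::ab_group_add \<Rightarrow> 'v" and V :: "'v set" +
  fixes br :: "'v \<Rightarrow> 'v \<Rightarrow> 'v"
  assumes br_bilinear: "bilinear_op br"
    and br_self: "x \<in> V \<Longrightarrow> br x x = 0"
    and jacobi: "\<lbrakk>x \<in> V; y \<in> V; z \<in> V\<rbrakk>
      \<Longrightarrow> br x (br y z) + br y (br z x) + br z (br x y) = 0"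

locale transposed_poisson_algebra =
  comm_assoc_algebra_on scale V mult + lie_algebra_on scale V br
  for scale :: "complex \<Rightarrow> 'v::ab_group_add \<Rightarrow> 'v" and V mult br +
  assumes mult_nonzero: "nonzero_op V mult"
    and br_nonzero: "nonzero_op V br"
    and transposed_leibniz: "\<lbrakk>x \<in> V; y \<in> V; z \<in> V\<rbrakk>
      \<Longrightarrow> scale 2 (mult z (br x y)) = br (mult z x) y + br x (mult z y)"

locale poisson_algebra =
  comm_assoc_algebra_on scale V mult + lie_algebra_on scale V br
  for scale :: "complex \<Rightarrow> 'v::ab_group_add \<Rightarrow> 'v" and V mult br +
  assumes leibniz: "\<lbrakk>x \<in> V; y \<in> V; z \<in> V\<rbrakk>
      \<Longrightarrow> br x (mult y z) = mult (br x y) z + mult y (br x z)"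

locale nontrivial_poisson_algebra = poisson_algebra scale V mult br
  for scale :: "complex \<Rightarrow> 'v::ab_group_add \<Rightarrow> 'v" and V mult br +
  assumes mult_nonzero: "nonzero_op V mult"
    and br_nonzero: "nonzero_op V br"


definition add_subgroup :: "complex set \<Rightarrow> bool" where
  "add_subgroup G \<longleftrightarrow> 0 \<in> G \<and> (\<forall>a\<in>G. \<forall>b\<in>G. a + b \<in> G) \<and> (\<forall>a\<in>G. - a \<in> G)"

text \<open>
  \<open>\<epsilon> 1, \<dots>, \<epsilon> \<nu>\<close> is a basis of \<open>G\<close> over the integers. Integer coefficient vectors are taken in
  \<open>extensional {1..\<nu>}\<close>, so that uniqueness concerns only the indices between 1 and \<open>\<nu>\<close>.
\<close>

definition is_int_coords :: "nat \<Rightarrow> (nat \<Rightarrow> complex) \<Rightarrow> complex \<Rightarrow> (nat \<Rightarrow> int) \<Rightarrow> bool" where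
  "is_int_coords \<nu> \<epsilon> a n \<longleftrightarrow>
     n \<in> extensional {1..\<nu>} \<and> a = (\<Sum>i=1..\<nu>. of_int (n i) * \<epsilon> i)"

definition is_int_basis :: "complex set \<Rightarrow> nat \<Rightarrow> (nat \<Rightarrow> complex) \<Rightarrow> bool" where
  "is_int_basis G \<nu> \<epsilon> \<longleftrightarrow>
     (\<forall>i\<in>{1..\<nu>}. \<epsilon> i \<in> G) \<and> (\<forall>a\<in>G. \<exists>!n. is_int_coords \<nu> \<epsilon> a n)"

definition int_coord :: "nat \<Rightarrow> (nat \<Rightarrow> complex) \<Rightarrow> complex \<Rightarrow> nat \<Rightarrow> int" where
  "int_coord \<nu> \<epsilon> a i = (THE n. is_int_coords \<nu> \<epsilon> a n) i"


text \<open>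
  Labels of basis elements; \<open>CLI i\<close> stands for $C_{LI}^{(i)}$. Which labels occur depends on
  \<open>G\<close> and on the parameter \<open>lam\<close>.
\<close>

datatype hv_gen = L complex | I complex | CL | CI | CLI nat

definition hv_gens :: "complex set \<Rightarrow> complex \<Rightarrow> nat \<Rightarrow> hv_gen set" where
  "hv_gens G lam \<nu> = L ` G \<union> I ` G \<union> {CL}
     \<union> (if lam = 0 then {CI, CLI 0} else {})
     \<union> (if lam = 1 then {CLI 1} else {})
     \<union> (if lam = -2 then CLI ` {2..\<nu>} else {})"

definition pscale :: "complex \<Rightarrow> ('k \<Rightarrow>\<^sub>0 complex) \<Rightarrow> ('k \<Rightarrow>\<^sub>0 complex)" where
  "pscale c x = Poly_Mapping.map ((*) c) x"

lemma lookup_pscale [simp]: "Poly_Mapping.lookup (pscale c x) k = c * Poly_Mapping.lookup x k"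
  by (simp add: pscale_def Poly_Mapping.map.rep_eq when_def)

lemma vector_space_pscale: "vector_space pscale"
  by unfold_locales (auto intro!: poly_mapping_eqI simp: lookup_add algebra_simps)

abbreviation bas :: "hv_gen \<Rightarrow> (hv_gen \<Rightarrow>\<^sub>0 complex)" where
  "bas k \<equiv> Poly_Mapping.single k 1"

text \<open>The complex vector space with basis \<open>hv_gens G lam \<nu>\<close>.\<close>

definition hv_space :: "complex set \<Rightarrow> complex \<Rightarrow> nat \<Rightarrow> (hv_gen \<Rightarrow>\<^sub>0 complex) set" where
  "hv_space G lam \<nu> = {x. Poly_Mapping.keys x \<subseteq> hv_gens G lam \<nu>}"

definition br_LI ::
  "complex \<Rightarrow> nat \<Rightarrow> (nat \<Rightarrow> complex) \<Rightarrow> complex \<Rightarrow> complex \<Rightarrow> (hv_gen \<Rightarrow>\<^sub>0 complex)" where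
  "br_LI lam \<nu> \<epsilon> a b = pscale (b - lam * a) (bas (I (a + b)))
     + (if a = - b then
          (if lam = 0 then pscale (a^2 + a) (bas (CLI 0)) else 0)
        + (if lam = 1 then pscale ((a^3 - a) / 12) (bas (CLI 1)) else 0)
        + (if lam = -2 then \<Sum>i=2..\<nu>. pscale (of_int (int_coord \<nu> \<epsilon> a i)) (bas (CLI i)) else 0)
        else 0)"

fun br_gen ::
  "complex \<Rightarrow> nat \<Rightarrow> (nat \<Rightarrow> complex) \<Rightarrow> hv_gen \<Rightarrow> hv_gen \<Rightarrow> (hv_gen \<Rightarrow>\<^sub>0 complex)" where
  "br_gen lam \<nu> \<epsilon> (L a) (L b) = pscale (b - a) (bas (L (a + b)))
     + (if a = - b then pscale ((a^3 - a) / 12) (bas CL) else 0)"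
| "br_gen lam \<nu> \<epsilon> (L a) (I b) = br_LI lam \<nu> \<epsilon> a b"
| "br_gen lam \<nu> \<epsilon> (I a) (L b) = - br_LI lam \<nu> \<epsilon> b a"
| "br_gen lam \<nu> \<epsilon> (I a) (I b) = (if a = - b \<and> lam = 0 then pscale a (bas CI) else 0)"
| "br_gen lam \<nu> \<epsilon> _ _ = 0"

definition hv_bracket ::
  "complex \<Rightarrow> nat \<Rightarrow> (nat \<Rightarrow> complex)
     \<Rightarrow> (hv_gen \<Rightarrow>\<^sub>0 complex) \<Rightarrow> (hv_gen \<Rightarrow>\<^sub>0 complex) \<Rightarrow> (hv_gen \<Rightarrow>\<^sub>0 complex)" where
  "hv_bracket lam \<nu> \<epsilon> x y =
     (\<Sum>p\<in>Poly_Mapping.keys x. \<Sum>q\<in>Poly_Mapping.keys y.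
        pscale (Poly_Mapping.lookup x p * Poly_Mapping.lookup y q) (br_gen lam \<nu> \<epsilon> p q))"

end

theory Submission
  imports Defs
begin

text \<open>
  The transposed Leibniz rule says that every multiplication operator \<open>\<phi>\<close> is a half-derivation:
  \<open>2 \<phi> [x, y] = [\<phi> x, y] + [x, \<phi> y]\<close>. Comparing coefficients at \<open>L d\<close> and \<open>I d\<close> gives functional
  equations over \<open>G\<close>, whose solutions are so rigid that commutativity of the product leaves no
  \<open>L d\<close> and \<open>I d\<close> components: for example \<open>L a \<cdot> L b\<close> is, modulo the ideal of the \<open>I c\<close> and the centre,
  a multiple of both \<open>L a\<close> and \<open>L b\<close>. So all products are central, whence \<open>2 \<phi> [x, y] = 0\<close> and
  \<open>\<phi>\<close> vanishes on the derived algebra. This is the whole algebra unless \<open>lam = -1\<close>, and then it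
  misses only \<open>I 0\<close>.
\<close>

section \<open>Coordinates of brackets with a basis element\<close>

lemma pscale_zero [simp]: "pscale c 0 = 0" "pscale 0 x = 0"
  by (auto intro: poly_mapping_eqI)

lemma pscale_minus_one: "pscale (- 1) x = - x"
  by (intro poly_mapping_eqI) simp

lemma sum_pscale_bas: "(\<Sum>k\<in>Poly_Mapping.keys x. pscale (Poly_Mapping.lookup x k) (bas k)) = x"
  by (intro poly_mapping_eqI)
     (auto simp: lookup_sum lookup_single when_def in_keys_iff if_distrib cong: if_cong)

lemma hv_bracket_bas: "hv_bracket lam \<nu> \<epsilon> (bas p) (bas q) = br_gen lam \<nu> \<epsilon> p q"
  by (intro poly_mapping_eqI) (simp add: hv_bracket_def)

text \<open>Brackets add degrees, so for fixed \<open>q\<close> and \<open>k\<close> at most one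
  label \<open>p0\<close> contributes and the defining double sum collapses to one term.\<close>

lemma lookup_hv_bracket_bas:
  assumes "\<And>p. p \<noteq> p0 \<Longrightarrow> Poly_Mapping.lookup (br_gen lam \<nu> \<epsilon> p q) k = 0"
  shows "Poly_Mapping.lookup (hv_bracket lam \<nu> \<epsilon> x (bas q)) k
    = Poly_Mapping.lookup x p0 * Poly_Mapping.lookup (br_gen lam \<nu> \<epsilon> p0 q) k"
proof -
  have "Poly_Mapping.lookup (hv_bracket lam \<nu> \<epsilon> x (bas q)) k
      = (\<Sum>p\<in>Poly_Mapping.keys x.
          Poly_Mapping.lookup x p * Poly_Mapping.lookup (br_gen lam \<nu> \<epsilon> p q) k)"
    by (simp add: hv_bracket_def lookup_sum)
  also have "\<dots> = (\<Sum>p\<in>Poly_Mapping.keys x. if p = p0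
          then Poly_Mapping.lookup x p0 * Poly_Mapping.lookup (br_gen lam \<nu> \<epsilon> p0 q) k else 0)"
    by (intro sum.cong) (auto simp: assms)
  finally show ?thesis
    by (auto simp: in_keys_iff)
qed

lemmas lookup_hv_simps = lookup_add lookup_minus lookup_uminus lookup_single lookup_sum when_def br_LI_def

lemma lookup_bracket_LL:
  "Poly_Mapping.lookup (hv_bracket lam \<nu> \<epsilon> x (bas (L b))) (L c)
    = (2 * b - c) * Poly_Mapping.lookup x (L (c - b))"
  by (subst lookup_hv_bracket_bas[where ?p0.0 = "L (c - b)"], case_tac p)
     (auto simp: lookup_hv_simps algebra_simps)

lemma lookup_bracket_LI:
  "Poly_Mapping.lookup (hv_bracket lam \<nu> \<epsilon> x (bas (L b))) (I c)
    = - (c - b - lam * b) * Poly_Mapping.lookup x (I (c - b))"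
  by (subst lookup_hv_bracket_bas[where ?p0.0 = "I (c - b)"], case_tac p)
     (auto simp: lookup_hv_simps algebra_simps)

lemma lookup_bracket_L_CL:
  "Poly_Mapping.lookup (hv_bracket lam \<nu> \<epsilon> x (bas (L b))) CL
    = - ((b^3 - b) / 12) * Poly_Mapping.lookup x (L (- b))"
  by (subst lookup_hv_bracket_bas[where ?p0.0 = "L (- b)"], case_tac p)
     (auto simp: lookup_hv_simps field_simps)

lemma lookup_bracket_L_CLI1:
  "Poly_Mapping.lookup (hv_bracket 1 \<nu> \<epsilon> x (bas (L b))) (CLI 1)
    = - ((b^3 - b) / 12) * Poly_Mapping.lookup x (I (- b))"
  by (subst lookup_hv_bracket_bas[where ?p0.0 = "I (- b)"], case_tac p)
     (auto simp: lookup_hv_simps field_simps)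

lemma lookup_bracket_IL:
  "Poly_Mapping.lookup (hv_bracket lam \<nu> \<epsilon> x (bas (I b))) (L c) = 0"
  \<comment> \<open>No label contributes here; \<open>CL\<close> is an arbitrary choice whose own
    bracket is zero.\<close>
  by (subst lookup_hv_bracket_bas[where ?p0.0 = CL], case_tac p)
     (auto simp: lookup_hv_simps)

lemma lookup_bracket_II:
  "Poly_Mapping.lookup (hv_bracket lam \<nu> \<epsilon> x (bas (I b))) (I c)
    = (b - lam * (c - b)) * Poly_Mapping.lookup x (L (c - b))"
  by (subst lookup_hv_bracket_bas[where ?p0.0 = "L (c - b)"], case_tac p)
     (auto simp: lookup_hv_simps algebra_simps)

fun central_gen :: "hv_gen \<Rightarrow> bool" where
  "central_gen (L a) = False"
| "central_gen (I a) = False"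
| "central_gen CL = True"
| "central_gen CI = True"
| "central_gen (CLI i) = True"

lemma br_gen_central:
  assumes "central_gen p \<or> central_gen q"
  shows "br_gen lam \<nu> \<epsilon> p q = 0"
  using assms by (cases p; cases q) auto

lemma hv_bracket_central:
  assumes "\<And>k. k \<in> Poly_Mapping.keys x \<Longrightarrow> central_gen k"
  shows "hv_bracket lam \<nu> \<epsilon> x y = 0" "hv_bracket lam \<nu> \<epsilon> y x = 0"
  using assms by (simp_all add: hv_bracket_def br_gen_central)

section \<open>Scalar equations indexed by \<open>G\<close>\<close>

text \<open>Cramer's rule. It separates an unknown of degree zero, such as one at \<open>L 0\<close>
  or \<open>I 0\<close>, from one at a central label when both occur in the same brackets.\<close>

lemma two_coeffs_zero:
  fixes x y p q r s :: complex
  assumes "p * x + q * y = 0" "r * x + s * y = 0" "p * s \<noteq> q * r"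
  shows "x = 0" "y = 0"
proof -
  have "(p * s - q * r) * x = s * (p * x + q * y) - q * (r * x + s * y)"
    by (simp add: algebra_simps)
  then show "x = 0" using assms by simp
  have "(p * s - q * r) * y = p * (r * x + s * y) - r * (p * x + q * y)"
    by (simp add: algebra_simps)
  then show "y = 0" using assms by simp
qed

text \<open>
  For \<open>lam = 1\<close> the first equation alone has the solutions \<open>A b (b + d) = u d\<close> of the Witt
  algebra; the cocycle equation kills them for \<open>d \<noteq> 0\<close>.
\<close>

lemma half_derivation_coeffs:
  fixes A :: "complex \<Rightarrow> complex \<Rightarrow> complex" and C :: "complex \<Rightarrow> complex"
  assumes G: "add_subgroup G" "g \<in> G" "g \<noteq> 0"
    and out: "\<And>b c. b \<in> G \<Longrightarrow> c \<notin> G \<Longrightarrow> A b c = 0"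
    and eq: "\<And>a b c. \<lbrakk>a \<in> G; b \<in> G; a + b \<noteq> 0\<rbrakk> \<Longrightarrow>
      2 * ((b - a) * A (a + b) c)
        = - (c - b - lam * b) * A a (c - b) + (c - a - lam * a) * A b (c - a)"
    and cocycle: "\<And>a b. \<lbrakk>lam = 1; a \<in> G; b \<in> G; a + b \<noteq> 0\<rbrakk> \<Longrightarrow>
      2 * ((b - a) * C (a + b))
        = - ((b^3 - b) / 12) * A a (- b) + ((a^3 - a) / 12) * A b (- a)"
    and b: "b \<in> G"
  shows "c \<noteq> b \<Longrightarrow> A b c = 0" and "b \<noteq> 0 \<Longrightarrow> A b b = lam * A 0 0"
proof -
  have zero: "0 \<in> G" and add: "\<And>a b. a \<in> G \<Longrightarrow> b \<in> G \<Longrightarrow> a + b \<in> G"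
    and minus: "\<And>a. a \<in> G \<Longrightarrow> - a \<in> G"
    using G(1) by (auto simp: add_subgroup_def)
  have double: "2 * a \<in> G" if "a \<in> G" for a
    using add[OF that that] by (simp only: mult_2)
  have triple: "3 * a \<in> G" if "a \<in> G" for a
    using add[OF double[OF that] that] by (simp add: algebra_simps)
  have eq0: "(2 * e - c) * A e c = ((1 + lam) * e - c) * A 0 (c - e)" if "e \<in> G" "e \<noteq> 0" for e c
    using eq[OF zero that(1), of c] that by (simp add: algebra_simps)
  have A0: "A 0 d = 0" if "d \<noteq> 0" for d
  proof (cases "d \<in> G")
    case True
    show ?thesis
    proof (cases "lam = 1")
      case False
      \<comment> \<open>At \<open>c = 2 * d\<close> the left factor of \<open>eq0\<close> vanishes,
        which leaves the factor \<open>lam - 1\<close> on the right.\<close>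
      have "((1 + lam) * d - 2 * d) * A 0 d = 0"
        using eq0[of d "2 * d"] True that by simp
      moreover have "(1 + lam) * d - 2 * d = (lam - 1) * d" by (simp add: algebra_simps)
      ultimately show ?thesis using False that by simp
    next
      case lam: True
      have shift: "A e (e + d) = A 0 d" if "e \<in> G" "e \<noteq> d" for e
      proof (cases "e = 0")
        case False
        have "(e - d) * A e (e + d) = (e - d) * A 0 d"
          using eq0[of e "e + d"] that False lam by (simp add: algebra_simps)
        then show ?thesis using that by simp
      qed simp
      have m: "- d \<in> G" "2 * d \<in> G" "- (3 * d) \<in> G"
        using True minus double triple by auto
      \<comment> \<open>The degree \<open>- d\<close> is split as \<open>0 + (- d)\<close> and as
        \<open>2 * d + (- (3 * d))\<close>. Eliminating \<open>C (- d)\<close> from the two cocycle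
        equations also cancels the linear terms and leaves a multiple of \<open>d^3\<close>.\<close>
      have E1: "2 * (- d * C (- d)) = ((d^3 - d) / 12) * A 0 d"
        using cocycle[OF lam zero m(1)] shift[OF m(1)] that by (simp add: field_simps)
      have E2: "2 * (- 5 * d * C (- d))
          = ((27 * d^3 - 3 * d) / 12) * A 0 d + ((8 * d^3 - 2 * d) / 12) * A 0 d"
      proof -
        have "A (2 * d) (3 * d) = A 0 d" "A (- (3 * d)) (- (2 * d)) = A 0 d"
          using shift[OF m(2)] shift[OF m(3)] that by (simp_all add: eq_neg_iff_add_eq_0)
        then show ?thesis
          using cocycle[OF lam m(2) m(3)] that by (simp add: power_mult_distrib field_simps)
      qed
      have "30 * d^3 * A 0 d = 12 * (((27 * d^3 - 3 * d) / 12) * A 0 d + ((8 * d^3 - 2 * d) / 12) * A 0 d)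
          - 60 * (((d^3 - d) / 12) * A 0 d)"
        by (simp add: field_simps)
      also have "\<dots> = 0"
        unfolding E1[symmetric] E2[symmetric] by simp
      finally show ?thesis using that by simp
    qed
  qed (simp add: out zero)
  have off: "A e c = 0" if "e \<in> G" "c \<noteq> e" "c \<noteq> 2 * e" for e c
  proof (cases "e = 0")
    case False
    then show ?thesis using eq0[of e c] A0[of "c - e"] that by simp
  qed (use that A0 in simp)
  show "A b c = 0" if "c \<noteq> b"
  proof (cases "c = 2 * b \<and> b \<noteq> 0")
    case True
    \<comment> \<open>The index \<open>c = 2 * b\<close> is where \<open>eq0\<close> degenerates;
      the splitting \<open>b = 2 * b + (- b)\<close> leads to indices covered by
      \<open>off\<close>.\<close>
    have "A (2 * b) (3 * b) = 0" "A (- b) 0 = 0"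
      using True off[of "2 * b" "3 * b"] off[of "- b" 0] b double minus by auto
    then have "(- 3 * b) * A b (2 * b) = 0"
      using eq[of "2 * b" "- b" "2 * b"] True b double minus by simp
    then show ?thesis using True by simp
  qed (use off b that in auto)
  show "A b b = lam * A 0 0" if "b \<noteq> 0"
    using eq0[OF b that, of b] that by (simp add: algebra_simps)
qed

text \<open>For \<open>a \<noteq> b\<close> the support of \<open>T a b\<close> lies in both
  \<open>{b}\<close> and \<open>{a}\<close>, so it is empty; \<open>diag\<close> then kills
  \<open>T b b b\<close> for nonzero \<open>b\<close> through the off-diagonal
  \<open>T b 0 0\<close>. Only \<open>T 0 0 0\<close> depends on \<open>\<mu>\<close>, which
  explains \<open>nz\<close>.\<close>

lemma symmetric_diagonal_zero:
  fixes T :: "complex \<Rightarrow> complex \<Rightarrow> complex \<Rightarrow> complex"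
  assumes G: "0 \<in> G" "g \<in> G" "g \<noteq> 0"
    and sym: "\<And>a b d. \<lbrakk>a \<in> G; b \<in> G\<rbrakk> \<Longrightarrow> T a b d = T b a d"
    and off: "\<And>a b d. \<lbrakk>a \<in> G; b \<in> G; d \<noteq> b\<rbrakk> \<Longrightarrow> T a b d = 0"
    and diag: "\<And>a b. \<lbrakk>a \<in> G; b \<in> G; b \<noteq> 0\<rbrakk> \<Longrightarrow> T a b b = \<mu> * T a 0 0"
    and ab: "a \<in> G" "b \<in> G" and nz: "\<mu> \<noteq> 0 \<or> a \<noteq> 0 \<or> b \<noteq> 0"
  shows "T a b d = 0"
proof -
  have neq: "T a b d = 0" if "a \<in> G" "b \<in> G" "a \<noteq> b" for a b d
    using that off[of a b d] off[of b a d] sym[of a b d] by (cases "d = b") auto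
  consider "a \<noteq> b \<or> d \<noteq> b" | "a = b" "d = b" "b \<noteq> 0" | "a = b" "d = b" "b = 0"
    by blast
  then show ?thesis
  proof cases
    case 1 then show ?thesis using neq off ab by blast
  next
    case 2 then show ?thesis using diag[OF ab(2,2)] neq[OF ab(2) G(1)] by simp
  next
    case 3
    \<comment> \<open>Here \<open>diag\<close> is read backwards, from the off-diagonal value
      \<open>T 0 g g = 0\<close>.\<close>
    then have "\<mu> * T 0 0 0 = 0"
      using diag[of 0 g] neq[of 0 g g] G by simp
    then show ?thesis using 3 nz by simp
  qed
qed

section \<open>The Lie algebra and linear functionals on it\<close>

text \<open>The Lie axioms are hypotheses: in the main theorem they come with the given transposed
  Poisson structure and need not be derived from the bracket formulas.\<close>

locale hv_lie_algebra =
  lie_algebra_on pscale "hv_space G lam \<nu>" "hv_bracket lam \<nu> \<epsilon>" for G lam \<nu> \<epsilon> +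
  assumes G: "add_subgroup G"
    and basis: "lam = -2 \<Longrightarrow> \<nu> \<ge> 1 \<and> is_int_basis G \<nu> \<epsilon>"
    and nonabelian: "nonzero_op (hv_space G lam \<nu>) (hv_bracket lam \<nu> \<epsilon>)"
begin

abbreviation V where "V \<equiv> hv_space G lam \<nu>"
abbreviation gens where "gens \<equiv> hv_gens G lam \<nu>"
abbreviation br where "br \<equiv> hv_bracket lam \<nu> \<epsilon>"
abbreviation gbr where "gbr \<equiv> br_gen lam \<nu> \<epsilon>"

lemma G_zero: "0 \<in> G" and G_add: "a \<in> G \<Longrightarrow> b \<in> G \<Longrightarrow> a + b \<in> G"
  and G_minus: "a \<in> G \<Longrightarrow> - a \<in> G"
  using G by (auto simp: add_subgroup_def)

lemma G_double: "a \<in> G \<Longrightarrow> 2 * a \<in> G"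
  using G_add[of a a] by (simp only: mult_2)

lemma L_gens [simp]: "L a \<in> gens \<longleftrightarrow> a \<in> G"
  and I_gens [simp]: "I a \<in> gens \<longleftrightarrow> a \<in> G"
  and CL_gens [simp]: "CL \<in> gens"
  and CI_gens [simp]: "CI \<in> gens \<longleftrightarrow> lam = 0"
  and CLI_gens: "CLI i \<in> gens \<longleftrightarrow>
    (lam = 0 \<and> i = 0) \<or> (lam = 1 \<and> i = 1) \<or> (lam = -2 \<and> i \<in> {2..\<nu>})"
  by (auto simp: hv_gens_def)

lemma bas_V [simp]: "bas k \<in> V \<longleftrightarrow> k \<in> gens"
  by (simp add: hv_space_def)

lemma V_add: "x \<in> V \<Longrightarrow> y \<in> V \<Longrightarrow> x + y \<in> V"
  and V_scale: "x \<in> V \<Longrightarrow> pscale c x \<in> V"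
  and V_zero: "0 \<in> V"
  and V_sum: "(\<And>i. i \<in> S \<Longrightarrow> f i \<in> V) \<Longrightarrow> sum f S \<in> V"
  using subspace_carrier by (auto simp: subspace_add subspace_scale subspace_0 subspace_sum)

lemma lookup_V: "x \<in> V \<Longrightarrow> k \<notin> gens \<Longrightarrow> Poly_Mapping.lookup x k = 0"
  by (auto simp: hv_space_def in_keys_iff)

lemma br_V: "x \<in> V \<Longrightarrow> y \<in> V \<Longrightarrow> br x y \<in> V"
  using br_bilinear by (simp add: bilinear_op_def)

lemma br_antisym:
  assumes "x \<in> V" "y \<in> V" shows "br x y = - br y x"
proof -
  have "br (x + y) (x + y) = br x x + br x y + (br y x + br y y)"
    using assms br_bilinear V_add[OF assms] by (simp add: bilinear_op_def)
  then show ?thesis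
    using assms br_self V_add[OF assms] by (simp add: eq_neg_iff_add_eq_0)
qed

text \<open>The intended instances are the coordinates of a linear map on \<open>V\<close>, so that
  vector identities become scalar equations.\<close>

definition linear_functional :: "((hv_gen \<Rightarrow>\<^sub>0 complex) \<Rightarrow> complex) \<Rightarrow> bool" where
  "linear_functional f \<longleftrightarrow> (\<forall>x\<in>V. \<forall>y\<in>V. f (x + y) = f x + f y) \<and> (\<forall>c. \<forall>x\<in>V. f (pscale c x) = c * f x)"

lemma linear_functionalD:
  assumes "linear_functional f"
  shows "x \<in> V \<Longrightarrow> y \<in> V \<Longrightarrow> f (x + y) = f x + f y"
    and "x \<in> V \<Longrightarrow> f (pscale c x) = c * f x"
    and "f 0 = 0"
    and "x \<in> V \<Longrightarrow> f (- x) = - f x"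
    and "x \<in> V \<Longrightarrow> y \<in> V \<Longrightarrow> f (x - y) = f x - f y"
proof -
  show neg: "f (- x) = - f x" if "x \<in> V" for x
    using assms that unfolding linear_functional_def by (metis pscale_minus_one mult_minus1)
  show "f (x - y) = f x - f y" if "x \<in> V" "y \<in> V"
  proof -
    have "- y \<in> V" using V_scale[OF that(2), of "- 1"] by (simp add: pscale_minus_one)
    then show ?thesis
      using assms that neg[OF that(2)] unfolding linear_functional_def by (metis add_uminus_conv_diff)
  qed
  have "f (pscale 0 0) = 0 * f 0"
    using assms V_zero unfolding linear_functional_def by blast
  then show "f 0 = 0" by simp
qed (use assms in \<open>auto simp: linear_functional_def\<close>)

lemma linear_functional_sum:
  assumes "linear_functional f" "\<And>i. i \<in> S \<Longrightarrow> g i \<in> V"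
  shows "f (sum g S) = (\<Sum>i\<in>S. f (g i))"
  using assms(2)
  by (induction S rule: infinite_finite_induct)
     (simp_all add: linear_functionalD[OF assms(1)] V_sum)

lemma linear_functional_expand:
  assumes f: "linear_functional f" and x: "x \<in> V"
  shows "f x = (\<Sum>k\<in>Poly_Mapping.keys x. Poly_Mapping.lookup x k * f (bas k))"
proof -
  have keys: "bas k \<in> V" if "k \<in> Poly_Mapping.keys x" for k
    using x that by (auto simp: hv_space_def)
  have "f x = f (\<Sum>k\<in>Poly_Mapping.keys x. pscale (Poly_Mapping.lookup x k) (bas k))"
    by (simp add: sum_pscale_bas)
  also have "\<dots> = (\<Sum>k\<in>Poly_Mapping.keys x. f (pscale (Poly_Mapping.lookup x k) (bas k)))"
    using keys by (intro linear_functional_sum[OF f] V_scale)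
  also have "\<dots> = (\<Sum>k\<in>Poly_Mapping.keys x. Poly_Mapping.lookup x k * f (bas k))"
    using keys by (intro sum.cong) (simp_all add: linear_functionalD(2)[OF f])
  finally show ?thesis .
qed

lemma functional_LL:
  assumes f: "linear_functional f" and "a \<in> G" "b \<in> G"
  shows "f (gbr (L a) (L b)) = (b - a) * f (bas (L (a + b)))
    + (if a = - b then (a^3 - a) / 12 * f (bas CL) else 0)"
  using assms
  by (simp add: linear_functionalD[OF f] V_scale V_zero G_add)

lemma functional_if:
  assumes f: "linear_functional f" and "P \<Longrightarrow> x \<in> V"
  shows "f (if P then x else 0) = (if P then f x else 0)"
    and "f (if P then pscale c x else 0) = (if P then c * f x else 0)"
  using assms(2) by (simp_all add: linear_functionalD[OF f])

lemma V_if: "(P \<Longrightarrow> x \<in> V) \<Longrightarrow> (if P then x else 0) \<in> V"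
  using V_zero by simp

lemma functional_LI:
  assumes f: "linear_functional f" and "a \<in> G" "b \<in> G"
  shows "f (gbr (L a) (I b)) = (b - lam * a) * f (bas (I (a + b)))
    + (if a = - b then (if lam = 0 then (a^2 + a) * f (bas (CLI 0)) else 0)
        + (if lam = 1 then (a^3 - a) / 12 * f (bas (CLI 1)) else 0)
        + (if lam = -2 then \<Sum>i=2..\<nu>. of_int (int_coord \<nu> \<epsilon> a i) * f (bas (CLI i)) else 0)
       else 0)"
proof -
  define S where "S = (\<Sum>i=2..\<nu>. pscale (of_int (int_coord \<nu> \<epsilon> a i)) (bas (CLI i)))"
  \<comment> \<open>A label \<open>CLI i\<close> lies in \<open>gens\<close> only for the matching
    value of \<open>lam\<close>, so linearity of \<open>f\<close> can be applied to each central
    term only within its own conditional.\<close>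
  have I: "bas (I (a + b)) \<in> V" and C0: "lam = 0 \<Longrightarrow> bas (CLI 0) \<in> V"
    and C1: "lam = 1 \<Longrightarrow> bas (CLI 1) \<in> V"
    and C2: "\<And>i. lam = -2 \<Longrightarrow> i \<in> {2..\<nu>} \<Longrightarrow> bas (CLI i) \<in> V"
    using assms G_add unfolding bas_V CLI_gens by auto
  have S: "lam = -2 \<Longrightarrow> S \<in> V"
    unfolding S_def by (intro V_sum V_scale C2)
  have "lam = -2 \<Longrightarrow> f S = (\<Sum>i=2..\<nu>. f (pscale (of_int (int_coord \<nu> \<epsilon> a i)) (bas (CLI i))))"
    unfolding S_def by (intro linear_functional_sum[OF f] V_scale C2)
  also have "lam = -2 \<Longrightarrow> \<dots> = (\<Sum>i=2..\<nu>. of_int (int_coord \<nu> \<epsilon> a i) * f (bas (CLI i)))"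
    by (intro sum.cong refl linear_functionalD(2)[OF f] C2)
  finally have fS: "lam = -2 \<Longrightarrow> f S = (\<Sum>i=2..\<nu>. of_int (int_coord \<nu> \<epsilon> a i) * f (bas (CLI i)))" .
  define X0 X1 X2 where "X0 = (if lam = 0 then pscale (a^2 + a) (bas (CLI 0)) else 0)"
    and "X1 = (if lam = 1 then pscale ((a^3 - a) / 12) (bas (CLI 1)) else 0)"
    and "X2 = (if lam = -2 then S else 0)"
  have X: "X0 \<in> V" "X1 \<in> V" "X2 \<in> V"
    unfolding X0_def X1_def X2_def
    by (rule V_if, rule V_scale, erule C0)
       (rule V_if, rule V_scale, erule C1, rule V_if, erule S)
  have fX: "f X0 = (if lam = 0 then (a^2 + a) * f (bas (CLI 0)) else 0)"
    "f X1 = (if lam = 1 then (a^3 - a) / 12 * f (bas (CLI 1)) else 0)"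
    "f X2 = (if lam = -2 then \<Sum>i=2..\<nu>. of_int (int_coord \<nu> \<epsilon> a i) * f (bas (CLI i)) else 0)"
    unfolding X0_def X1_def X2_def
    by (rule functional_if(2)[OF f], erule C0)
       (rule functional_if(2)[OF f], erule C1,
        rule trans[OF functional_if(1)[OF f]], erule S, simp add: fS)
  have "gbr (L a) (I b) = pscale (b - lam * a) (bas (I (a + b))) + (if a = - b then X0 + X1 + X2 else 0)"
    by (simp only: br_gen.simps br_LI_def X0_def X1_def X2_def S_def)
  then show ?thesis
    unfolding fX[symmetric]
    by (simp only: linear_functionalD[OF f] functional_if(1)[OF f] V_if V_add X V_scale I)
qed

lemma functional_II:
  assumes f: "linear_functional f"
  shows "f (gbr (I a) (I b)) = (if a = - b \<and> lam = 0 then a * f (bas CI) else 0)"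
proof -
  have "a = - b \<and> lam = 0 \<Longrightarrow> bas CI \<in> V"
    unfolding bas_V CI_gens by simp
  then show ?thesis
    unfolding br_gen.simps by (rule functional_if(2)[OF f])
qed

section \<open>Integer coordinates for \<open>lam = -2\<close>\<close>

lemma coords_unique:
  assumes "lam = -2" "a \<in> G" "is_int_coords \<nu> \<epsilon> a m" "is_int_coords \<nu> \<epsilon> a n"
  shows "m = n"
  using basis assms unfolding is_int_basis_def by blast

text \<open>The value \<open>undefined\<close> outside \<open>{1..\<nu>}\<close> is forced by
  \<open>extensional\<close>.\<close>

lemma coords_basis:
  assumes "j \<in> {1..\<nu>}"
  shows "is_int_coords \<nu> \<epsilon> (\<epsilon> j) (\<lambda>i. if i \<in> {1..\<nu>} then (if i = j then 1 else 0) else undefined)"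
proof -
  have "(\<Sum>i=1..\<nu>. of_int (if i \<in> {1..\<nu>} then (if i = j then 1 else 0) else undefined) * \<epsilon> i)
      = (\<Sum>i=1..\<nu>. if i = j then \<epsilon> j else 0)"
    by (intro sum.cong) auto
  then show ?thesis
    using assms by (auto simp: is_int_coords_def extensional_def)
qed

lemma int_coord_basis:
  assumes lam: "lam = -2" and "j \<in> {1..\<nu>}" "i \<in> {1..\<nu>}"
  shows "int_coord \<nu> \<epsilon> (\<epsilon> j) i = (if i = j then 1 else 0)"
proof -
  have "\<epsilon> j \<in> G" using basis assms by (auto simp: is_int_basis_def)
  then have "(THE n. is_int_coords \<nu> \<epsilon> (\<epsilon> j) n)
      = (\<lambda>i. if i \<in> {1..\<nu>} then (if i = j then 1 else 0) else undefined)"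
    using coords_basis[OF assms(2)] coords_unique[OF lam] by blast
  then show ?thesis using assms by (simp add: int_coord_def)
qed

text \<open>If \<open>\<epsilon> j\<close> were zero, the zero vector and a unit vector would both
  be coordinates of \<open>0\<close>, against uniqueness.\<close>

lemma basis_nonzero:
  assumes lam: "lam = -2" and j: "j \<in> {1..\<nu>}"
  shows "\<epsilon> j \<in> G" "\<epsilon> j \<noteq> 0"
proof -
  show "\<epsilon> j \<in> G" using basis assms by (auto simp: is_int_basis_def)
  show "\<epsilon> j \<noteq> 0"
  proof
    assume "\<epsilon> j = 0"
    moreover have "is_int_coords \<nu> \<epsilon> 0 (\<lambda>i. if i \<in> {1..\<nu>} then 0 else undefined)"
      by (auto simp: is_int_coords_def extensional_def)
    ultimately have "(\<lambda>i. if i \<in> {1..\<nu>} then 0 else undefined)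
        = (\<lambda>i. if i \<in> {1..\<nu>} then (if i = j then 1 else 0) else (undefined :: int))"
      using coords_unique[OF lam G_zero] coords_basis[OF j] by simp
    from fun_cong[OF this, of j] j show False by simp
  qed
qed

section \<open>Nonzero degrees and the derived algebra\<close>

text \<open>For \<open>lam = -2\<close> a basis element serves. For other \<open>lam\<close>, all
  brackets among \<open>L 0\<close> and \<open>I 0\<close> vanish, so \<open>G = {0}\<close> would
  contradict \<open>nonabelian\<close>.\<close>

lemma obtain_nonzero:
  obtains g where "g \<in> G" "g \<noteq> 0"
proof (cases "\<exists>g\<in>G. g \<noteq> 0")
  case False
  have lam: "lam \<noteq> -2"
    using basis basis_nonzero[of 1] False by auto
  have "gbr p q = 0" if "p \<in> gens" "q \<in> gens" for p q
  proof (cases "central_gen p \<or> central_gen q")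
    case False
    have "p = L 0 \<or> p = I 0" "q = L 0 \<or> q = I 0"
      using that False \<open>\<not> (\<exists>g\<in>G. g \<noteq> 0)\<close> by (cases p; cases q; auto)+
    then show ?thesis
      using lam by (auto simp: br_LI_def)
  qed (rule br_gen_central)
  then have "br x y = 0" if "x \<in> V" "y \<in> V" for x y
    using that unfolding hv_bracket_def hv_space_def
    by (intro sum.neutral ballI) (auto simp: subset_iff)
  then have False using nonabelian by (auto simp: nonzero_op_def)
  then show ?thesis ..
qed (use that in blast)

text \<open>Dual form of the statement that the derived algebra contains these basis elements. The
  exception arises because \<open>[L a, I (- a)]\<close> has coefficient
  \<open>- a - lam * a\<close> at \<open>I 0\<close>, which is zero for
  \<open>lam = -1\<close>.\<close>

lemma functional_zero:
  assumes f: "linear_functional f"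
    and br0: "\<And>p q. p \<in> gens \<Longrightarrow> q \<in> gens \<Longrightarrow> f (gbr p q) = 0"
    and k: "k \<in> gens" "lam = -1 \<Longrightarrow> k \<noteq> I 0"
  shows "f (bas k) = 0"
proof -
  obtain g where g: "g \<in> G" "g \<noteq> 0" by (rule obtain_nonzero)
  have LL: "(b - a) * f (bas (L (a + b))) + (if a = - b then (a^3 - a) / 12 * f (bas CL) else 0) = 0"
    if "a \<in> G" "b \<in> G" for a b
    using functional_LL[OF f that] br0[of "L a" "L b"] that by simp
  note LI = functional_LI[OF f, symmetric]
  have LI0: "f (gbr (L a) (I b)) = 0" if "a \<in> G" "b \<in> G" for a b
    using br0[of "L a" "I b"] that by simp
  have *: "f (bas (L 0)) = 0 \<and> f (bas CL) = 0"
  proof -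
    \<comment> \<open>Opposite degrees at \<open>g\<close> and at \<open>2 * g\<close> give two
      equations in the values at \<open>L 0\<close> and \<open>CL\<close>; their determinant is
      \<open>- g^4\<close>.\<close>
    have "(- 2 * g) * f (bas (L 0)) + (g^3 - g) / 12 * f (bas CL) = 0"
      using LL[of g "- g"] g G_minus by simp
    moreover have "(- 4 * g) * f (bas (L 0)) + (8 * g^3 - 2 * g) / 12 * f (bas CL) = 0"
      using LL[of "2 * g" "- (2 * g)"] g G_minus G_double by (simp add: power_mult_distrib)
    moreover have "(- 2 * g) * ((8 * g^3 - 2 * g) / 12) \<noteq> (g^3 - g) / 12 * (- 4 * g)"
      using g by (simp add: field_simps power3_eq_cube)
    ultimately show ?thesis using two_coeffs_zero by blast
  qed
  have fL: "f (bas (L e)) = 0" if "e \<in> G" for e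
    using LL[of 0 e] that G_zero * by (cases "e = 0") auto
  have fI: "f (bas (I e)) = 0" if "e \<in> G" "e \<noteq> 0" for e
    using LI[of 0 e] LI0[of 0 e] that G_zero by auto
  consider "lam = -1" | "lam = 0" | "lam = 1" | "lam = -2" | "lam \<notin> {-1,0,1,-2}" by blast
  then have rest: "(lam \<noteq> -1 \<longrightarrow> f (bas (I 0)) = 0) \<and> (\<forall>i. CLI i \<in> gens \<longrightarrow> f (bas (CLI i)) = 0)"
  proof cases
    case 2
    \<comment> \<open>The cocycle \<open>a^2 + a\<close> is not odd, so \<open>g\<close> and
      \<open>- g\<close> already give independent equations, with determinant
      \<open>- 2 * g^3\<close>.\<close>
    have "(- g) * f (bas (I 0)) + (g^2 + g) * f (bas (CLI 0)) = 0"
      "g * f (bas (I 0)) + (g^2 - g) * f (bas (CLI 0)) = 0"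
      using LI[of g "- g"] LI0[of g "- g"] LI[of "- g" g] LI0[of "- g" g] g G_minus 2 by simp_all
    moreover have "(- g) * (g^2 - g) \<noteq> (g^2 + g) * g"
      using g by (simp add: algebra_simps power2_eq_square eq_neg_iff_add_eq_0)
    ultimately have "f (bas (I 0)) = 0" "f (bas (CLI 0)) = 0" using two_coeffs_zero by blast+
    then show ?thesis using 2 unfolding CLI_gens by auto
  next
    case 3
    have "(- 2 * g) * f (bas (I 0)) + (g^3 - g) / 12 * f (bas (CLI 1)) = 0"
      using LI[of g "- g"] LI0[of g "- g"] g G_minus 3 by simp
    moreover have "(- 4 * g) * f (bas (I 0)) + (8 * g^3 - 2 * g) / 12 * f (bas (CLI 1)) = 0"
      using LI[of "2 * g" "- (2 * g)"] LI0[of "2 * g" "- (2 * g)"] g G_minus G_double 3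
      by (simp add: power_mult_distrib)
    moreover have "(- 2 * g) * ((8 * g^3 - 2 * g) / 12) \<noteq> (g^3 - g) / 12 * (- 4 * g)"
      using g by (simp add: field_simps power3_eq_cube)
    ultimately have "f (bas (I 0)) = 0" "f (bas (CLI 1)) = 0" using two_coeffs_zero by blast+
    then show ?thesis using 3 unfolding CLI_gens by auto
  next
    case 4
    have sum: "(\<Sum>i=2..\<nu>. of_int (int_coord \<nu> \<epsilon> (\<epsilon> j) i) * f (bas (CLI i)))
        = (if j \<in> {2..\<nu>} then f (bas (CLI j)) else 0)" if "j \<in> {1..\<nu>}" for j
    proof -
      have "(\<Sum>i=2..\<nu>. of_int (int_coord \<nu> \<epsilon> (\<epsilon> j) i) * f (bas (CLI i)))
          = (\<Sum>i=2..\<nu>. if i = j then f (bas (CLI j)) else 0)"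
        using int_coord_basis[OF 4 that] by (intro sum.cong) auto
      then show ?thesis by simp
    qed
    have eps: "\<epsilon> j * f (bas (I 0)) + (if j \<in> {2..\<nu>} then f (bas (CLI j)) else 0) = 0"
      if j: "j \<in> {1..\<nu>}" for j
      using LI[of "\<epsilon> j" "- \<epsilon> j"] LI0[of "\<epsilon> j" "- \<epsilon> j"] basis_nonzero[OF 4 j] G_minus 4
      unfolding sum[OF j] by (simp add: sum[OF j])
    \<comment> \<open>The central sum starts at \<open>2\<close>, so \<open>\<epsilon> 1\<close> has
      no central term and isolates \<open>I 0\<close>; the other basis elements then give each
      \<open>CLI i\<close>.\<close>
    have "f (bas (I 0)) = 0"
      using eps[of 1] basis basis_nonzero[OF 4, of 1] 4 by auto
    moreover have "f (bas (CLI i)) = 0" if "i \<in> {2..\<nu>}" for i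
      using eps[of i] that calculation by simp
    ultimately show ?thesis using 4 unfolding CLI_gens by auto
  next
    case 5
    have "1 + lam \<noteq> 0" using 5 by (auto simp: add_eq_0_iff)
    moreover have "(- g - lam * g) * f (bas (I 0)) = 0"
      using LI[of g "- g"] LI0[of g "- g"] g G_minus 5 by simp
    moreover have "- g - lam * g = - ((1 + lam) * g)" by (simp add: algebra_simps)
    ultimately show ?thesis using 5 g by (auto simp: CLI_gens)
  qed (unfold CLI_gens, auto)
  have "f (bas CI) = 0" if "lam = 0"
  proof -
    have gens: "I g \<in> gens" "I (- g) \<in> gens" using g G_minus by simp_all
    show ?thesis
      using functional_II[OF f, of g "- g"] br0[OF gens] g that by simp
  qed
  note fCI = this
  show ?thesis
  proof (cases k)
    case (I e)
    show ?thesis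
    proof (cases "e = 0")
      case True
      then have "lam \<noteq> -1" using k(2) I by auto
      then show ?thesis using rest True I by simp
    qed (use fI k(1) I in simp)
  next
    case (CLI i)
    then show ?thesis using rest k(1) by blast
  next
    case CI
    then have "lam = 0" using k(1) by simp
    then show ?thesis using fCI CI by simp
  qed (use k(1) fL * in simp_all)
qed

text \<open>With the central terms gone, by degree or by vanishing of \<open>f\<close>, one formula
  covers every \<open>lam\<close>.\<close>

lemma functional_LI_central:
  assumes f: "linear_functional f" and ab: "a \<in> G" "b \<in> G"
    and central: "\<And>i. a = - b \<Longrightarrow> CLI i \<in> gens \<Longrightarrow> f (bas (CLI i)) = 0"
  shows "f (gbr (L a) (I b)) = (b - lam * a) * f (bas (I (a + b)))"
proof (cases "a = - b")
  case True
  note c = central[OF True, unfolded CLI_gens]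
  have "(if lam = 0 then (a^2 + a) * f (bas (CLI 0)) else 0) = 0"
    "(if lam = 1 then (a^3 - a) / 12 * f (bas (CLI 1)) else 0) = 0"
    "(if lam = -2 then \<Sum>i=2..\<nu>. of_int (int_coord \<nu> \<epsilon> a i) * f (bas (CLI i)) else 0) = 0"
    using c by (auto intro!: sum.neutral)
  then show ?thesis by (simp only: functional_LI[OF f ab] add_0_right if_cancel)
qed (simp only: functional_LI[OF f ab] if_False add_0_right)

section \<open>Coefficients of half-derivations\<close>

definition half_derivation :: "((hv_gen \<Rightarrow>\<^sub>0 complex) \<Rightarrow> (hv_gen \<Rightarrow>\<^sub>0 complex)) \<Rightarrow> bool" where
  "half_derivation \<phi> \<longleftrightarrow> (\<forall>x\<in>V. \<phi> x \<in> V)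
     \<and> (\<forall>k. linear_functional (\<lambda>x. Poly_Mapping.lookup (\<phi> x) k))
     \<and> (\<forall>x\<in>V. \<forall>y\<in>V. pscale 2 (\<phi> (br x y)) = br (\<phi> x) y + br x (\<phi> y))"

context
  fixes \<phi> assumes hd: "half_derivation \<phi>"
begin

abbreviation coef :: "hv_gen \<Rightarrow> hv_gen \<Rightarrow> complex" where
  "coef p k \<equiv> Poly_Mapping.lookup (\<phi> (bas p)) k"

lemma hd_functional: "linear_functional (\<lambda>x. Poly_Mapping.lookup (\<phi> x) k)"
  using hd by (simp add: half_derivation_def)

lemma hd_out: "p \<in> gens \<Longrightarrow> k \<notin> gens \<Longrightarrow> coef p k = 0"
  using hd by (intro lookup_V) (simp_all add: half_derivation_def)

text \<open>Antisymmetry moves the basis element to the right in both brackets, the form in which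
  their coordinates are known.\<close>

lemma hd_coef:
  assumes p: "p \<in> gens" "q \<in> gens"
  shows "2 * Poly_Mapping.lookup (\<phi> (gbr p q)) k
    = Poly_Mapping.lookup (br (\<phi> (bas p)) (bas q)) k - Poly_Mapping.lookup (br (\<phi> (bas q)) (bas p)) k"
proof -
  have V: "bas p \<in> V" "bas q \<in> V" "\<phi> (bas q) \<in> V"
    using p hd by (simp_all add: half_derivation_def)
  have "pscale 2 (\<phi> (gbr p q)) = br (\<phi> (bas p)) (bas q) + br (bas p) (\<phi> (bas q))"
    using V hd hv_bracket_bas[of lam \<nu> \<epsilon> p q] unfolding half_derivation_def by metis
  also have "\<dots> = br (\<phi> (bas p)) (bas q) - br (\<phi> (bas q)) (bas p)"
    using br_antisym[OF V(1,3)] by simp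
  finally have "Poly_Mapping.lookup (pscale 2 (\<phi> (gbr p q))) k
      = Poly_Mapping.lookup (br (\<phi> (bas p)) (bas q) - br (\<phi> (bas q)) (bas p)) k"
    by simp
  then show ?thesis by (simp add: lookup_minus)
qed

lemma hd_bracket_LL:
  assumes "a \<in> G" "b \<in> G"
  shows "2 * ((b - a) * coef (L (a + b)) k + (if a = - b then (a^3 - a) / 12 * coef CL k else 0))
    = Poly_Mapping.lookup (br (\<phi> (bas (L a))) (bas (L b))) k
      - Poly_Mapping.lookup (br (\<phi> (bas (L b))) (bas (L a))) k"
  using hd_coef[of "L a" "L b" k] functional_LL[OF hd_functional, of a b k] assms by simp

text \<open>Both \<open>[p, L b]\<close> and \<open>[p, \<phi> (L b)]\<close> vanish, so the image
  of a central element commutes with every \<open>L b\<close>.\<close>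

lemma hd_central:
  assumes p: "p \<in> gens" "central_gen p" and b: "b \<in> G"
  shows "Poly_Mapping.lookup (br (\<phi> (bas p)) (bas (L b))) k = 0"
proof -
  have "br (\<phi> (bas (L b))) (bas p) = 0"
    by (rule hv_bracket_central) (use p in simp)
  moreover have "gbr p (L b) = 0"
    using p by (simp add: br_gen_central)
  ultimately show ?thesis
    using hd_coef[of p "L b" k] p b linear_functionalD(3)[OF hd_functional, of k] by simp
qed

lemma hd_central_L:
  assumes p: "p \<in> gens" "central_gen p"
  shows "coef p (L d) = 0"
proof -
  obtain g where "g \<in> G" "g \<noteq> 0" by (rule obtain_nonzero)
  \<comment> \<open>The bracket \<open>[L d, L b]\<close> has coefficient \<open>b - d\<close>; one
    of \<open>0\<close> and \<open>g\<close> differs from \<open>d\<close>.\<close>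
  then obtain b where b: "b \<in> G" "b \<noteq> d" using G_zero by metis
  show ?thesis
    using hd_central[OF p b(1), of "L (b + d)"] b by (simp add: lookup_bracket_LL)
qed

text \<open>Bracketing with \<open>L b\<close> gives the factor \<open>d - lam * b\<close>. It is
  zero for all \<open>b\<close> in \<open>G\<close> only if \<open>lam = 0\<close> and
  \<open>d = 0\<close>; in that case the central labels are treated later, as terms of
  brackets.\<close>

lemma hd_central_I:
  assumes p: "p \<in> gens" "central_gen p" and "lam \<noteq> 0 \<or> d \<noteq> 0"
  shows "coef p (I d) = 0"
proof -
  obtain g where g: "g \<in> G" "g \<noteq> 0" by (rule obtain_nonzero)
  have "(d - lam * b) * coef p (I d) = 0" if "b \<in> G" for b
    using hd_central[OF p that, of "I (b + d)"] by (auto simp: lookup_bracket_LI)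
  from this[OF G_zero] this[OF g(1)] show ?thesis
    using assms g by (cases "d = 0") auto
qed

text \<open>The \<open>L a\<close> act on the \<open>L d\<close> as they act on the
  \<open>I d\<close> for \<open>lam = 1\<close>, with \<open>CL\<close> in the role of
  \<open>CLI 1\<close>; hence the instance at \<open>1\<close>.\<close>

lemma hd_L_L:
  assumes "b \<in> G"
  shows "d \<noteq> b \<Longrightarrow> coef (L b) (L d) = 0" and "b \<noteq> 0 \<Longrightarrow> coef (L b) (L b) = coef (L 0) (L 0)"
proof -
  obtain g where g: "g \<in> G" "g \<noteq> 0" by (rule obtain_nonzero)
  \<comment> \<open>Degree zero is left out because \<open>[L a, L (- a)]\<close> also has a
    \<open>CL\<close> term.\<close>
  have eq: "2 * ((b - a) * coef (L (a + b)) (L c))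
      = - (c - b - 1 * b) * coef (L a) (L (c - b)) + (c - a - 1 * a) * coef (L b) (L (c - a))"
    if "a \<in> G" "b \<in> G" "a + b \<noteq> 0" for a b c
  proof -
    have "a \<noteq> - b" using that by auto
    then show ?thesis
      using hd_bracket_LL[OF that(1,2), of "L c"] by (simp add: lookup_bracket_LL) (simp add: algebra_simps)
  qed
  have cocycle: "2 * ((b - a) * coef (L (a + b)) CL)
      = - ((b^3 - b) / 12) * coef (L a) (L (- b)) + ((a^3 - a) / 12) * coef (L b) (L (- a))"
    if "a \<in> G" "b \<in> G" "a + b \<noteq> 0" for a b
  proof -
    have "a \<noteq> - b" using that by auto
    then show ?thesis
      using hd_bracket_LL[OF that(1,2), of CL] by (simp add: lookup_bracket_L_CL)
  qed
  have out: "coef (L b) (L c) = 0" if "b \<in> G" "c \<notin> G" for b c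
    by (rule hd_out) (use that in simp_all)
  show "coef (L b) (L d) = 0" if "d \<noteq> b"
    by (rule half_derivation_coeffs(1)[OF G g, where lam = "1"
          and A = "\<lambda>b c. coef (L b) (L c)" and C = "\<lambda>b. coef (L b) CL"])
       ((rule out eq cocycle; assumption) | rule assms that)+
  have "coef (L b) (L b) = 1 * coef (L 0) (L 0)" if "b \<noteq> 0"
    by (rule half_derivation_coeffs(2)[OF G g, where lam = "1"
          and A = "\<lambda>b c. coef (L b) (L c)" and C = "\<lambda>b. coef (L b) CL"])
       ((rule out eq cocycle; assumption) | rule assms that)+
  then show "b \<noteq> 0 \<Longrightarrow> coef (L b) (L b) = coef (L 0) (L 0)" by simp
qed

lemma hd_L_I:
  assumes "b \<in> G"
  shows "d \<noteq> b \<Longrightarrow> coef (L b) (I d) = 0" and "b \<noteq> 0 \<Longrightarrow> coef (L b) (I b) = lam * coef (L 0) (I 0)"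
proof -
  obtain g where g: "g \<in> G" "g \<noteq> 0" by (rule obtain_nonzero)
  have eq: "2 * ((b - a) * coef (L (a + b)) (I c))
      = - (c - b - lam * b) * coef (L a) (I (c - b)) + (c - a - lam * a) * coef (L b) (I (c - a))"
    if "a \<in> G" "b \<in> G" "a + b \<noteq> 0" for a b c
  proof -
    have "a \<noteq> - b" using that by auto
    then show ?thesis
      using hd_bracket_LL[OF that(1,2), of "I c"] by (simp add: lookup_bracket_LI) (simp add: algebra_simps)
  qed
  have cocycle: "2 * ((b - a) * coef (L (a + b)) (CLI 1))
      = - ((b^3 - b) / 12) * coef (L a) (I (- b)) + ((a^3 - a) / 12) * coef (L b) (I (- a))"
    if "lam = 1" "a \<in> G" "b \<in> G" "a + b \<noteq> 0" for a b
  proof -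
    have "a \<noteq> - b" using that by auto
    then show ?thesis
      using hd_bracket_LL[OF that(2,3), of "CLI 1"]
      unfolding that(1) lookup_bracket_L_CLI1 by simp
  qed
  have out: "coef (L b) (I c) = 0" if "b \<in> G" "c \<notin> G" for b c
    by (rule hd_out) (use that in simp_all)
  show "coef (L b) (I d) = 0" if "d \<noteq> b"
    by (rule half_derivation_coeffs(1)[OF G g, where lam = "lam"
          and A = "\<lambda>b c. coef (L b) (I c)" and C = "\<lambda>b. coef (L b) (CLI 1)"])
       ((rule out eq cocycle; assumption) | rule assms that)+
  have "coef (L b) (I b) = lam * coef (L 0) (I 0)" if "b \<noteq> 0"
    by (rule half_derivation_coeffs(2)[OF G g, where lam = "lam"
          and A = "\<lambda>b c. coef (L b) (I c)" and C = "\<lambda>b. coef (L b) (CLI 1)"])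
       ((rule out eq cocycle; assumption) | rule assms that)+
  then show "b \<noteq> 0 \<Longrightarrow> coef (L b) (I b) = lam * coef (L 0) (I 0)" by simp
qed

lemma hd_I_L:
  assumes b: "b \<in> G"
  shows "coef (I b) (L e) = 0"
proof -
  obtain g where g: "g \<in> G" "g \<noteq> 0" by (rule obtain_nonzero)
  have eq: "2 * ((b - lam * a) * coef (I (a + b)) (L e)) = (e - 2 * a) * coef (I b) (L (e - a))"
    if "a \<in> G" "b \<in> G" for a b e
  proof -
    have "2 * ((b - lam * a) * coef (I (a + b)) (L e)) = - ((2 * a - e) * coef (I b) (L (e - a)))"
      using hd_coef[of "L a" "I b" "L e"] functional_LI_central[OF hd_functional that, of "L e"] that
      by (simp add: hd_central_L lookup_bracket_IL lookup_bracket_LL)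
    then show ?thesis by (simp add: algebra_simps)
  qed
  have off: "coef (I b) (L e) = 0" if "b \<in> G" "e \<noteq> 2 * b" for b e
    using eq[OF G_zero that(1), of e] that by simp
  have nonzero: "coef (I b) (L e) = 0" if "b \<in> G" "b \<noteq> 0" for b e
  proof (cases "e = 2 * b")
    case True
    \<comment> \<open>At the surviving index, splitting \<open>b\<close> as \<open>b + 0\<close> and
      as \<open>- b + 2 * b\<close> gives the factors \<open>lam\<close> and \<open>2 + lam\<close>,
      which do not both vanish.\<close>
    have lam_b: "(lam * b) * coef (I b) (L e) = 0"
      using eq[OF that(1) G_zero, of "2 * b"] True by simp
    have "(2 * b + lam * b) * coef (I b) (L e) = 0"
      using eq[OF G_minus[OF that(1)] G_double[OF that(1)], of "2 * b"]
        off[OF G_double[OF that(1)], of "3 * b"] True that by simp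
    then have "((2 + lam) * b) * coef (I b) (L e) = 0" by (simp only: distrib_right)
    then show ?thesis using that lam_b by (cases "lam = 0") auto
  qed (rule off[OF that(1)])
  have "coef (I 0) (L 0) = 0"
  proof (cases "lam = -1")
    case True
    \<comment> \<open>For \<open>lam = -1\<close> the brackets \<open>[L a, I (- a)]\<close> are
      zero and say nothing about \<open>I 0\<close>; the relation \<open>[I 0, I g] = 0\<close>
      replaces them.\<close>
    have gens: "I 0 \<in> gens" "I g \<in> gens" using g G_zero by simp_all
    have "g * coef (I 0) (L 0) + lam * g * coef (I g) (L g) = 0"
      using hd_coef[OF gens, of "I g"] g True
        linear_functionalD(3)[OF hd_functional, of "I g"]
      by (simp add: lookup_bracket_II)
    then show ?thesis using nonzero g by simp
  next
    case False
    have "coef (I (- g)) (L (- g)) = 0"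
      using nonzero[OF G_minus[OF g(1)]] g(2) by simp
    then have "(- g - lam * g) * coef (I 0) (L 0) = 0"
      using eq[OF g(1) G_minus[OF g(1)], of 0] by simp
    moreover have "- g - lam * g = - ((1 + lam) * g)" by (simp add: algebra_simps)
    moreover have "1 + lam \<noteq> 0" using False by (simp add: add_eq_0_iff)
    ultimately show ?thesis using g by simp
  qed
  then show ?thesis
    using nonzero[OF b] off[OF b, of e] by (cases "b = 0"; cases "e = 0") simp_all
qed

section \<open>Half-derivations whose images have no component along \<open>L d\<close>\<close>

context
  assumes coef_L: "\<And>p d. p \<in> gens \<Longrightarrow> coef p (L d) = 0"
begin

text \<open>By \<open>coef_L\<close>, the bracket of \<open>\<phi> (L a)\<close> with
  \<open>I b\<close> has no \<open>I\<close> component, so only the term with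
  \<open>\<phi> (I b)\<close> remains.\<close>

lemma hd_bracket_LI_I:
  assumes "a \<in> G" "b \<in> G"
  shows "2 * Poly_Mapping.lookup (\<phi> (gbr (L a) (I b))) (I e) = (e - a - lam * a) * coef (I b) (I (e - a))"
proof -
  have "2 * Poly_Mapping.lookup (\<phi> (gbr (L a) (I b))) (I e)
      = - (- (e - a - lam * a) * coef (I b) (I (e - a)))"
    using hd_coef[of "L a" "I b" "I e"] assms
    by (simp only: lookup_bracket_II lookup_bracket_LI coef_L L_gens I_gens mult_zero_right diff_0)
  then show ?thesis by (simp only: mult_minus_left minus_minus)
qed

lemma hd_I_I_nonzero:
  assumes b: "b \<in> G" "b \<noteq> 0"
  shows "coef (I b) (I e) = 0"
proof -
  have eq: "2 * ((b - lam * a) * coef (I (a + b)) (I e)) = (e - a - lam * a) * coef (I b) (I (e - a))"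
    if "a \<in> G" "b \<in> G" "a + b \<noteq> 0" for a b e
  proof -
    have "a \<noteq> - b" using that by auto
    then show ?thesis
      using hd_bracket_LI_I[OF that(1,2), of e] functional_LI_central[OF hd_functional that(1,2), of "I e"] by simp
  qed
  have off: "coef (I b) (I e) = 0" if "b \<in> G" "b \<noteq> 0" "e \<noteq> 2 * b" for b e
    using eq[OF G_zero that(1), of e] that by simp
  show ?thesis
  proof (cases "e = 2 * b")
    case True
    \<comment> \<open>Taking the summands \<open>- b\<close> and \<open>2 * b\<close> in both orders
      gives the factors \<open>2 + lam\<close> and \<open>1 + 2 * lam\<close>, which have no common
      zero.\<close>
    have "(2 * b + lam * b) * coef (I b) (I e) = 0"
      using eq[of "- b" "2 * b" "2 * b"] off[of "2 * b" "3 * b"] True b G_minus G_double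
      by simp
    then have "((2 + lam) * b) * coef (I b) (I e) = 0" by (simp only: distrib_right)
    moreover have "((1 + 2 * lam) * b) * coef (I b) (I e) = 0"
    proof -
      have "2 * ((- b - lam * (2 * b)) * coef (I b) (I e)) = 0"
        using eq[of "2 * b" "- b" "2 * b"] off[of "- b" 0] True b G_minus G_double by simp
      moreover have "- b - lam * (2 * b) = - ((1 + 2 * lam) * b)"
        by (simp add: algebra_simps)
      ultimately show ?thesis by simp
    qed
    moreover have "2 + lam \<noteq> 0 \<or> 1 + 2 * lam \<noteq> 0"
      by (auto simp: add_eq_0_iff)
    ultimately show ?thesis using b by auto
  qed (rule off[OF b])
qed

text \<open>For \<open>lam = 0\<close> the bracket \<open>[L a, I (- a)]\<close> mixes
  \<open>I 0\<close> with \<open>CLI 0\<close>, so the two coefficients are found together.\<close>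

lemma hd_I_I_CLI0: "coef (I 0) (I e) = 0 \<and> (lam = 0 \<longrightarrow> coef (CLI 0) (I e) = 0)"
proof -
  obtain g where g: "g \<in> G" "g \<noteq> 0" by (rule obtain_nonzero)
  have bracket: "Poly_Mapping.lookup (\<phi> (gbr (L a) (I (- a)))) (I e) = 0" if "a \<in> G" "a \<noteq> 0" for a
    using hd_bracket_LI_I[of a "- a" e] hd_I_I_nonzero[of "- a"] that G_minus by simp
  show ?thesis
  proof (cases "lam = 0")
    case True
    have "(- a) * coef (I 0) (I e) + (a^2 + a) * coef (CLI 0) (I e) = 0" if "a \<in> G" "a \<noteq> 0" for a
      using functional_LI[OF hd_functional that(1) G_minus[OF that(1)], of "I e"] bracket[OF that] True by simp
    from this[OF g] this[of "- g"]
    have "(- g) * coef (I 0) (I e) + (g^2 + g) * coef (CLI 0) (I e) = 0"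
      "g * coef (I 0) (I e) + (g^2 - g) * coef (CLI 0) (I e) = 0"
      using g G_minus by simp_all
    moreover have "(- g) * (g^2 - g) \<noteq> (g^2 + g) * g"
      using g by (simp add: algebra_simps power2_eq_square eq_neg_iff_add_eq_0)
    ultimately show ?thesis using two_coeffs_zero by blast
  next
    case lam0: False
    have "coef (I 0) (I e) = 0"
    proof (cases "lam = -1")
      case True
      \<comment> \<open>Again \<open>[L a, I (- a)]\<close> is zero, so \<open>[L a, I 0]\<close> is
        used. It produces the factor \<open>e + a\<close>, which \<open>a\<close> must keep
        nonzero.\<close>
      obtain a where a: "a \<in> G" "a \<noteq> 0" "e + a \<noteq> 0"
      proof (cases "e + g = 0")
        case True
        then have "e = - g" by (simp add: eq_neg_iff_add_eq_0)
        then have "e + - g \<noteq> 0" using g by simp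
        with that[of "- g"] g G_minus show ?thesis by simp
      qed (use that[of g] g in simp)
      have "a \<noteq> - 0" using a by simp
      then have "2 * (- lam * a * coef (I a) (I (e + a))) = (e + a - a - lam * a) * coef (I 0) (I e)"
        using hd_bracket_LI_I[OF a(1) G_zero, of "e + a"]
          functional_LI_central[OF hd_functional a(1) G_zero, of "I (e + a)"] by simp
      then show ?thesis
        using hd_I_I_nonzero[OF a(1,2)] a True by simp
    next
      case False
      have "(- g - lam * g) * coef (I 0) (I e) = 0"
        using functional_LI_central[OF hd_functional g(1) G_minus[OF g(1)], of "I e"]
          hd_central_I bracket[OF g] lam0 by simp
      moreover have "- g - lam * g = - ((1 + lam) * g)" by (simp add: algebra_simps)
      ultimately show ?thesis using g False by (auto simp: add_eq_0_iff)
    qed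
    then show ?thesis using lam0 by simp
  qed
qed

lemma hd_I_I: "b \<in> G \<Longrightarrow> coef (I b) (I e) = 0"
  using hd_I_I_nonzero hd_I_I_CLI0 by (cases "b = 0") auto

lemma hd_CLI_I: "CLI i \<in> gens \<Longrightarrow> coef (CLI i) (I e) = 0"
  using hd_I_I_CLI0 hd_central_I[of "CLI i" e] CLI_gens[of i] by (cases "lam = 0") auto

text \<open>\<open>CI\<close> is reached through \<open>[I g, I (- g)]\<close>; the \<open>I\<close>
  components of the brackets on the other side involve only \<open>L\<close> components of images,
  which are zero.\<close>

lemma hd_CI_I:
  assumes "CI \<in> gens"
  shows "coef CI (I e) = 0"
proof -
  obtain g where g: "g \<in> G" "g \<noteq> 0" by (rule obtain_nonzero)
  have lam: "lam = 0" using assms by simp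
  have gens: "I g \<in> gens" "I (- g) \<in> gens" using g G_minus by simp_all
  have "coef (I g) (L d) = 0" "coef (I (- g)) (L d) = 0" for d
    by (rule coef_L, rule gens)+
  then have "2 * (g * coef CI (I e)) = 0"
    using hd_coef[OF gens, of "I e"] functional_II[OF hd_functional, of g "- g" "I e"] lam
    by (simp add: lookup_bracket_II)
  then show ?thesis using g by simp
qed

end

text \<open>The brackets \<open>[L a, L (- a)]\<close> express \<open>L 0\<close> and
  \<open>CL\<close> through nonzero degrees, and \<open>a = g\<close>, \<open>a = 2 * g\<close>
  separate the two.\<close>

lemma hd_L0_CL_I:
  assumes "\<And>b d. b \<in> G \<Longrightarrow> b \<noteq> 0 \<Longrightarrow> coef (L b) (I d) = 0"
  shows "coef (L 0) (I e) = 0" "coef CL (I e) = 0"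
proof -
  obtain g where g: "g \<in> G" "g \<noteq> 0" by (rule obtain_nonzero)
  have "(- 2 * a) * coef (L 0) (I e) + (a^3 - a) / 12 * coef CL (I e) = 0" if "a \<in> G" "a \<noteq> 0" for a
    using hd_bracket_LL[of a "- a" "I e"] assms that G_minus by (simp add: lookup_bracket_LI)
  from this[OF g] this[of "2 * g"]
  have "(- 2 * g) * coef (L 0) (I e) + (g^3 - g) / 12 * coef CL (I e) = 0"
    "(- 4 * g) * coef (L 0) (I e) + (8 * g^3 - 2 * g) / 12 * coef CL (I e) = 0"
    using g G_double by (simp_all add: power_mult_distrib)
  moreover have "(- 2 * g) * ((8 * g^3 - 2 * g) / 12) \<noteq> (g^3 - g) / 12 * (- 4 * g)"
    using g by (simp add: field_simps power3_eq_cube)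
  ultimately show "coef (L 0) (I e) = 0" "coef CL (I e) = 0" using two_coeffs_zero by blast+
qed

end

end

section \<open>Products in a transposed Poisson structure\<close>

locale hv_transposed_poisson = hv_lie_algebra +
  fixes mult
  assumes cas: "comm_assoc_algebra_on pscale V mult"
    and tleibniz: "\<lbrakk>x \<in> V; y \<in> V; z \<in> V\<rbrakk>
      \<Longrightarrow> pscale 2 (mult z (br x y)) = br (mult z x) y + br x (mult z y)"
begin

abbreviation m :: "hv_gen \<Rightarrow> hv_gen \<Rightarrow> hv_gen \<Rightarrow> complex" where
  "m p q k \<equiv> Poly_Mapping.lookup (mult (bas p) (bas q)) k"

lemma mult_V: "x \<in> V \<Longrightarrow> y \<in> V \<Longrightarrow> mult x y \<in> V"
  and mult_add_right: "x \<in> V \<Longrightarrow> y \<in> V \<Longrightarrow> z \<in> V \<Longrightarrow> mult x (y + z) = mult x y + mult x z"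
  and mult_scale_right: "x \<in> V \<Longrightarrow> y \<in> V \<Longrightarrow> mult x (pscale c y) = pscale c (mult x y)"
  and mult_comm: "x \<in> V \<Longrightarrow> y \<in> V \<Longrightarrow> mult x y = mult y x"
  using cas by (auto simp: comm_assoc_algebra_on_def comm_assoc_algebra_on_axioms_def bilinear_op_def)

lemma m_comm: "p \<in> gens \<Longrightarrow> q \<in> gens \<Longrightarrow> m p q k = m q p k"
  using mult_comm[of "bas p" "bas q"] by simp

lemma mult_functional: "x \<in> V \<Longrightarrow> linear_functional (\<lambda>y. Poly_Mapping.lookup (mult x y) k)"
  by (simp add: linear_functional_def mult_add_right mult_scale_right lookup_add)

lemma mult_half_derivation: "p \<in> gens \<Longrightarrow> half_derivation (mult (bas p))"
  unfolding half_derivation_def using mult_V mult_functional tleibniz by simp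

text \<open>If the factors are not both of the form \<open>L a\<close>, commutativity puts one of
  another form on the right, where the half-derivation results apply. Two such factors fall under
  \<open>symmetric_diagonal_zero\<close> with \<open>\<mu> = 1\<close>.\<close>

lemma m_L:
  assumes p: "p \<in> gens" and q: "q \<in> gens"
  shows "m p q (L d) = 0"
proof -
  obtain g where g: "g \<in> G" "g \<noteq> 0" by (rule obtain_nonzero)
  have sym: "m (L a) (L b) (L d) = m (L b) (L a) (L d)" if "a \<in> G" "b \<in> G" for a b d
    by (rule m_comm) (use that in simp_all)
  have off: "m (L a) (L b) (L d) = 0" if "a \<in> G" "b \<in> G" "d \<noteq> b" for a b d
    by (rule hd_L_L(1)[OF mult_half_derivation]) (use that in simp_all)
  have diag: "m (L a) (L b) (L b) = 1 * m (L a) (L 0) (L 0)" if "a \<in> G" "b \<in> G" "b \<noteq> 0" for a b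
    using hd_L_L(2)[OF mult_half_derivation that(2,3), of "L a"] that by simp
  have LL: "m (L a) (L b) (L d) = 0" if "a \<in> G" "b \<in> G" for a b
    by (rule symmetric_diagonal_zero[OF G_zero g, where T = "\<lambda>a b d. m (L a) (L b) (L d)",
          OF sym off diag that]) simp_all
  have other: "m p q (L d) = 0" if "p \<in> gens" "q \<in> gens" "\<And>b. q \<noteq> L b" for p q
  proof (cases q)
    case (I b)
    then show ?thesis using hd_I_L[OF mult_half_derivation[OF that(1)]] that(2) by simp
  qed (use hd_central_L[OF mult_half_derivation[OF that(1)] that(2)] that(3) in auto)
  show ?thesis
  proof (cases "(\<exists>a. p = L a) \<and> (\<exists>b. q = L b)")
    case True
    then show ?thesis using LL p q by auto
  next
    case False
    then show ?thesis
      using other[OF p q] other[OF q p] m_comm[OF p q] by metis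
  qed
qed

text \<open>The order of cases is dictated by \<open>lam = 0\<close>: then
  \<open>symmetric_diagonal_zero\<close>, used with \<open>\<mu> = lam\<close>, misses the product
  of \<open>L 0\<close> with itself, and \<open>hd_central_I\<close> misses \<open>CL\<close>. Both
  come last, from \<open>hd_L0_CL_I\<close>.\<close>

lemma m_I:
  assumes p: "p \<in> gens" and q: "q \<in> gens"
  shows "m p q (I d) = 0"
proof -
  obtain g where g: "g \<in> G" "g \<noteq> 0" by (rule obtain_nonzero)
  have other: "m p q (I d) = 0" if "p \<in> gens" "q \<in> gens" "\<And>b. q \<noteq> L b" "q \<noteq> CL" for p q d
  proof (cases q)
    case (I b)
    then show ?thesis using hd_I_I[OF mult_half_derivation[OF that(1)] m_L[OF that(1)]] that(2) by simp
  next
    case (CLI i)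
    then show ?thesis using hd_CLI_I[OF mult_half_derivation[OF that(1)] m_L[OF that(1)]] that(2) by blast
  next
    case CI
    then show ?thesis using hd_CI_I[OF mult_half_derivation[OF that(1)] m_L[OF that(1)]] that(2) by blast
  qed (use that in auto)
  have sym: "m (L a) (L b) (I d) = m (L b) (L a) (I d)" if "a \<in> G" "b \<in> G" for a b d
    by (rule m_comm) (use that in simp_all)
  have off: "m (L a) (L b) (I d) = 0" if "a \<in> G" "b \<in> G" "d \<noteq> b" for a b d
    by (rule hd_L_I(1)[OF mult_half_derivation]) (use that in simp_all)
  have diag: "m (L a) (L b) (I b) = lam * m (L a) (L 0) (I 0)" if "a \<in> G" "b \<in> G" "b \<noteq> 0" for a b
    using hd_L_I(2)[OF mult_half_derivation that(2,3), of "L a"] that by simp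
  have LL: "m (L a) (L b) (I d) = 0" if "a \<in> G" "b \<in> G" "b \<noteq> 0" for a b d
    by (rule symmetric_diagonal_zero[OF G_zero g, where T = "\<lambda>a b d. m (L a) (L b) (I d)",
          OF sym off diag that(1,2)]) (use that in simp_all)
  have L_gen: "L a \<in> gens" if "a \<in> G" for a using that by simp
  have L: "m p (L b) (I d) = 0" if "p \<in> gens" "b \<in> G" "b \<noteq> 0" "p \<noteq> CL" for p b d
  proof (cases "\<exists>a. p = L a")
    case True
    then show ?thesis using LL that by auto
  next
    case False
    then show ?thesis
      using other[OF L_gen[OF that(2)] that(1)] that(4) m_comm[OF that(1) L_gen[OF that(2)]] by metis
  qed
  have L0_CL: "m p (L 0) (I d) = 0 \<and> m p CL (I d) = 0" if "p \<in> gens" "p \<noteq> CL" for p d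
    using hd_L0_CL_I[OF mult_half_derivation[OF that(1)]] L that by blast
  have L': "m p (L b) (I d) = 0" if "p \<in> gens" "b \<in> G" for p b d
  proof (cases "p = CL")
    case True
    then show ?thesis
      using L0_CL[OF L_gen[OF that(2)]] m_comm[OF that(1) L_gen[OF that(2)]] by simp
  next
    case False
    then show ?thesis using L[OF that] L0_CL[OF that(1)] by (cases "b = 0") auto
  qed
  \<comment> \<open>Since \<open>L'\<close> admits the left factor \<open>CL\<close>, this second
    use of \<open>hd_L0_CL_I\<close> includes the square of \<open>CL\<close>.\<close>
  have CL: "m p CL (I d) = 0" if "p \<in> gens" for p
    using hd_L0_CL_I(2)[OF mult_half_derivation[OF that]] L'[OF that] by blast
  show ?thesis
    using other[OF p q] L'[OF p] CL[OF p] q by (cases q) auto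
qed

text \<open>Bilinear extension from the basis. The predicate \<open>P\<close> on the labels of the
  left factor is trivial when products are shown to be central, and excludes \<open>I 0\<close> for
  \<open>lam = -1\<close> in \<open>mult_zero\<close>.\<close>

lemma mult_zero_extend:
  assumes "\<And>p q. \<lbrakk>p \<in> gens; q \<in> gens; P p\<rbrakk> \<Longrightarrow> m p q k = 0"
    and x: "x \<in> V" "\<And>p. p \<in> Poly_Mapping.keys x \<Longrightarrow> P p" and y: "y \<in> V"
  shows "Poly_Mapping.lookup (mult x y) k = 0"
proof -
  have "Poly_Mapping.lookup (mult y (bas p)) k = 0" if p: "p \<in> Poly_Mapping.keys x" for p
  proof -
    have gens: "p \<in> gens" using x p by (auto simp: hv_space_def)
    have "Poly_Mapping.lookup (mult (bas p) y) k
        = (\<Sum>q\<in>Poly_Mapping.keys y. Poly_Mapping.lookup y q * m p q k)"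
      using gens y by (intro linear_functional_expand mult_functional) simp_all
    also have "\<dots> = 0"
      using assms(1)[OF gens _ x(2)[OF p]] y by (intro sum.neutral) (auto simp: hv_space_def)
    finally show ?thesis using mult_comm[OF y, of "bas p"] gens by simp
  qed
  then show ?thesis
    using linear_functional_expand[OF mult_functional[OF y] x(1), of k] mult_comm[OF x(1) y] by simp
qed

lemma mult_central:
  assumes "x \<in> V" "y \<in> V" "k \<in> Poly_Mapping.keys (mult x y)"
  shows "central_gen k"
proof -
  have "Poly_Mapping.lookup (mult x y) (L d) = 0" for d
    by (rule mult_zero_extend[where P = "\<lambda>_. True"]) (use assms m_L in auto)
  moreover have "Poly_Mapping.lookup (mult x y) (I d) = 0" for d
    by (rule mult_zero_extend[where P = "\<lambda>_. True"]) (use assms m_I in auto)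
  ultimately show ?thesis
    using assms(3) by (cases k) (auto simp: in_keys_iff)
qed

lemma bracket_mult_zero:
  assumes "x \<in> V" "y \<in> V"
  shows "br (mult x y) z = 0" "br z (mult x y) = 0"
  using hv_bracket_central mult_central[OF assms] by blast+

text \<open>Central products make the right side of the transposed Leibniz rule zero, so
  \<open>functional_zero\<close> applies to multiplication by \<open>bas p\<close>. Commutativity
  allows either factor to be the one other than \<open>I 0\<close>.\<close>

lemma m_zero:
  assumes p: "p \<in> gens" and q: "q \<in> gens" and "lam = -1 \<Longrightarrow> (p, q) \<noteq> (I 0, I 0)"
  shows "m p q k = 0"
proof -
  have zero: "m p q k = 0" if "p \<in> gens" "q \<in> gens" "lam = -1 \<Longrightarrow> q \<noteq> I 0" for p q
  proof (rule functional_zero[OF mult_functional])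
    show "bas p \<in> V" using that by simp
    fix p' q'
    assume pq: "p' \<in> gens" "q' \<in> gens"
    have "pscale 2 (mult (bas p) (br (bas p') (bas q'))) = 0"
      using tleibniz[of "bas p'" "bas q'" "bas p"] pq that by (simp add: bracket_mult_zero)
    then have "Poly_Mapping.lookup (pscale 2 (mult (bas p) (gbr p' q'))) k = 0"
      by (simp add: hv_bracket_bas)
    then show "Poly_Mapping.lookup (mult (bas p) (gbr p' q')) k = 0" by simp
  qed (use that in simp_all)
  show ?thesis
    using zero[OF p q] zero[OF q p] m_comm[OF p q] assms(3) by (metis (no_types) prod.inject)
qed

lemma mult_zero:
  assumes x: "x \<in> V" "lam = -1 \<Longrightarrow> Poly_Mapping.lookup x (I 0) = 0" and y: "y \<in> V"
  shows "mult x y = 0"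
proof (rule poly_mapping_eqI)
  fix k
  have "Poly_Mapping.lookup (mult x y) k = 0"
    by (rule mult_zero_extend[where P = "\<lambda>p. lam = -1 \<longrightarrow> p \<noteq> I 0", OF m_zero x(1) _ y])
       (use x(2) in \<open>auto simp: in_keys_iff\<close>)
  then show "Poly_Mapping.lookup (mult x y) k = Poly_Mapping.lookup 0 k" by simp
qed

section \<open>The Leibniz rule and the remaining product\<close>

text \<open>For \<open>lam = -1\<close> the coefficient \<open>b - lam * a\<close> is
  \<open>a + b\<close>, which is zero exactly in the degree of \<open>I 0\<close>.\<close>

lemma lookup_bracket_I0:
  assumes "lam = -1"
  shows "Poly_Mapping.lookup (br x y) (I 0) = 0"
proof -
  have "Poly_Mapping.lookup (gbr p q) (I 0) = 0" for p q
    using assms by (cases p; cases q) (auto simp: lookup_hv_simps add_eq_0_iff)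
  then show ?thesis by (simp add: hv_bracket_def lookup_sum)
qed

text \<open>All three terms vanish: products are central, and brackets satisfy the condition of
  \<open>mult_zero\<close>.\<close>

lemma leibniz:
  assumes "x \<in> V" "y \<in> V" "z \<in> V"
  shows "br x (mult y z) = mult (br x y) z + mult y (br x z)"
  using assms mult_zero[OF br_V lookup_bracket_I0] mult_comm[OF _ br_V]
  by (simp add: bracket_mult_zero)

lemma mult_bas_zero:
  assumes "p \<in> gens" "q \<in> gens" "(p, q) \<noteq> (I 0, I 0)"
  shows "mult (bas p) (bas q) = 0"
  using m_zero[OF assms(1,2)] assms(3) by (intro poly_mapping_eqI) simp

text \<open>The product is central, and for \<open>lam = -1\<close> the only central label in
  \<open>gens\<close> is \<open>CL\<close>.\<close>

lemma mult_I0: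
  assumes "lam = -1"
  shows "mult (bas (I 0)) (bas (I 0)) = pscale (m (I 0) (I 0) CL) (bas CL)"
proof (rule poly_mapping_eqI)
  fix k
  have V: "bas (I 0) \<in> V" using G_zero by simp
  have "m (I 0) (I 0) k = 0" if "k \<noteq> CL"
  proof (cases "central_gen k")
    case True
    then have "k \<notin> gens"
      using that assms by (cases k) (auto simp: hv_gens_def)
    then show ?thesis using lookup_V[OF mult_V[OF V V]] by simp
  next
    case False
    then show ?thesis using mult_central[OF V V] by (auto simp: in_keys_iff)
  qed
  then show "m (I 0) (I 0) k = Poly_Mapping.lookup (pscale (m (I 0) (I 0) CL) (bas CL)) k"
    by (auto simp: lookup_single when_def)
qed

end

theorem theorem12:
  fixes lam :: complex and G :: "complex set" and \<nu> :: nat and \<epsilon> :: "nat \<Rightarrow> complex"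
    and mult :: "(hv_gen \<Rightarrow>\<^sub>0 complex) \<Rightarrow> (hv_gen \<Rightarrow>\<^sub>0 complex) \<Rightarrow> (hv_gen \<Rightarrow>\<^sub>0 complex)"
  assumes G: "add_subgroup G"
    and basis: "lam = -2 \<Longrightarrow> \<nu> \<ge> 1 \<and> is_int_basis G \<nu> \<epsilon>"
    and tpa: "transposed_poisson_algebra pscale (hv_space G lam \<nu>) mult (hv_bracket lam \<nu> \<epsilon>)"
  shows "lam = -1
    \<and> nontrivial_poisson_algebra pscale (hv_space G lam \<nu>) mult (hv_bracket lam \<nu> \<epsilon>)
    \<and> (\<exists>\<beta>. mult (bas (I 0)) (bas (I 0)) = pscale \<beta> (bas CL)
          \<and> (\<forall>p\<in>hv_gens G lam \<nu>. \<forall>q\<in>hv_gens G lam \<nu>.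
                (p, q) \<noteq> (I 0, I 0) \<longrightarrow> mult (bas p) (bas q) = 0))"
proof -
  interpret T: transposed_poisson_algebra pscale "hv_space G lam \<nu>" mult "hv_bracket lam \<nu> \<epsilon>"
    by (rule tpa)
  interpret hv_lie_algebra G lam \<nu> \<epsilon>
    by unfold_locales (use G basis T.br_nonzero in auto)
  interpret hv_transposed_poisson G lam \<nu> \<epsilon> mult
    by unfold_locales
       (use T.comm_assoc_algebra_on_axioms T.transposed_leibniz in
         \<open>auto simp: comm_assoc_algebra_on_def\<close>)
  \<comment> \<open>For any other \<open>lam\<close> the condition in \<open>mult_zero\<close> is
    vacuous and \<open>mult\<close> would be zero on \<open>V\<close>.\<close>
  have lam: "lam = -1"
    using T.mult_nonzero mult_zero by (auto simp: nonzero_op_def)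
  have "nontrivial_poisson_algebra pscale V mult br"
    by unfold_locales (use leibniz T.mult_nonzero T.br_nonzero in auto)
  then show ?thesis
    using lam mult_I0[OF lam] mult_bas_zero by blast
qed

end
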